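(* Let $(\mathfrak g,B)$ be a reduced singular quadratic Lie algebra with center $\mathscr Z(\mathfrak g)$, and let $D:\mathfrak g\to\mathfrak g$ be a linear map that is symmetric with respect to $B$. Then: (1) $D$ is a centromorphism if and only if there exist $\mu\in\mathbb C$ and a symmetric map $\mathsf Z:\mathfrak g\to\mathscr Z(\mathfrak g)$ such that $\mathsf Z|_{[\mathfrak g,\mathfrak g]}=0$ and $D=\mu\,\mathrm{Id}+\mathsf Z$. Moreover $D$ is invertible if and only if $\mu\ne0$. (2) The quadratic dimension of $\mathfrak g$ is $$d_q(\mathfrak g)=1+\frac{\dim(\mathscr Z(\mathfrak g))\,\bigl(1+\dim(\mathscr Z(\mathfrak g))\bigr)}{2}.$$
   Context: All vector spaces are finite-dimensional over $\mathbb C$. A quadratic Lie algebra $(\mathfrak g,B)$ is a Lie algebra with a non-degenerate symmetric invariant bilinear form ($B([X,Y],Z)=B(X,[Y,Z])$). Let $I(X,Y,Z)=B([X,Y],Z)$ and $\mathrm{dup}(\mathfrak g)=\dim\{\alpha\in\mathfrak g^*\mid\alpha\wedge I=0\}$; a non-Abelian quadratic Lie algebra is singular if $\mathrm{dup}(\mathfrak g)\ge1$. A quadratic Lie algebra $\mathfrak g\ne\{0\}$ is reduced if its center is totally isotropic. A linear map $D$ is symmetric if $B(D(X),Y)=B(X,D(Y))$ for all $X,Y$. A centromorphism of $\mathfrak g$ is a symmetric linear map $D$ satisfying $D([X,Y])=[D(X),Y]=[X,D(Y)]$ for all $X,Y\in\mathfrak g$. The quadratic dimension $d_q(\mathfrak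 g)$ is the dimension of the space of invariant symmetric bilinear forms on $\mathfrak g$ (which equals the dimension of the space of centromorphisms). In (1), the "Moreover" sentence refers to a centromorphism $D=\mu\,\mathrm{Id}+\mathsf Z$ as described. *)

theory Defs
  imports Complex_Main "HOL-Library.Function_Algebras"
begin

section \<open>Lie algebras and quadratic Lie algebras over the complex numbers\<close>

locale lie_algebra = vector_space scale
  for scale :: "complex \<Rightarrow> 'g::ab_group_add \<Rightarrow> 'g" +
  fixes bracket :: "'g \<Rightarrow> 'g \<Rightarrow> 'g"
  assumes finite_dim: "\<exists>S. finite S \<and> span S = UNIV"
    and linear_bracket_left: "Vector_Spaces.linear scale scale (\<lambda>X. bracket X Y)"
    and linear_bracket_right: "Vector_Spaces.linear scale scale (\<lambda>Y. bracket X Y)"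
    and bracket_self: "bracket X X = 0"
    and jacobi: "bracket X (bracket Y Z) + bracket Y (bracket Z X) + bracket Z (bracket X Y) = 0"
begin

definition abelian :: bool
  where "abelian \<longleftrightarrow> (\<forall>X Y. bracket X Y = 0)"

definition center :: "'g set"
  where "center = {X. \<forall>Y. bracket X Y = 0}"

definition derived_algebra :: "'g set"
  where "derived_algebra = span {bracket X Y | X Y. True}"

definition bilinear_form :: "('g \<Rightarrow> 'g \<Rightarrow> complex) \<Rightarrow> bool"
  where "bilinear_form b \<longleftrightarrow>
    (\<forall>Y. Vector_Spaces.linear scale (*) (\<lambda>X. b X Y)) \<and>
    (\<forall>X. Vector_Spaces.linear scale (*) (\<lambda>Y. b X Y))"

definition symmetric_form :: "('g \<Rightarrow> 'g \<Rightarrow> complex) \<Rightarrow> bool"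
  where "symmetric_form b \<longleftrightarrow> (\<forall>X Y. b X Y = b Y X)"

definition invariant_form :: "('g \<Rightarrow> 'g \<Rightarrow> complex) \<Rightarrow> bool"
  where "invariant_form b \<longleftrightarrow> (\<forall>X Y Z. b (bracket X Y) Z = b X (bracket Y Z))"

definition nondegenerate_form :: "('g \<Rightarrow> 'g \<Rightarrow> complex) \<Rightarrow> bool"
  where "nondegenerate_form b \<longleftrightarrow> (\<forall>X. (\<forall>Y. b X Y = 0) \<longrightarrow> X = 0)"

text \<open>
  Linear functionals and bilinear forms are functions into the complex numbers, and dimensions of
  spaces of them are taken in the complex vector space of all such functions, with
  pointwise operations (zero and addition come from \<^theory>\<open>HOL-Library.Function_Algebras\<close>).
  The sets measured below are finite-dimensional subspaces of it.
\<close>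

definition quadratic_dim :: nat
  where "quadratic_dim = vector_space.dim (\<lambda>c b X Y. c * b X Y)
    {b. bilinear_form b \<and> symmetric_form b \<and> invariant_form b}"

end

lemma vector_space_functionals:
  "vector_space (\<lambda>c (f :: 'a \<Rightarrow> complex) x. c * f x)"
  by unfold_locales (auto simp: fun_eq_iff algebra_simps)

lemma vector_space_bilinear_forms:
  "vector_space (\<lambda>c (b :: 'a \<Rightarrow> 'a \<Rightarrow> complex) x y. c * b x y)"
  by unfold_locales (auto simp: fun_eq_iff algebra_simps)

text \<open>
  Exterior product of a 1-form with an alternating 3-form, as the signed sum over the
  (1,3)-shuffles. Other normalisations differ by a nonzero factor, so they have the same kernel.
\<close>

definition wedge_1_3 ::
  "('a \<Rightarrow> complex) \<Rightarrow> ('a \<Rightarrow> 'a \<Rightarrow> 'a \<Rightarrow> complex) \<Rightarrow> 'a \<Rightarrow> 'a \<Rightarrow> 'a \<Rightarrow> 'a \<Rightarrow> complex"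
  where "wedge_1_3 \<alpha> \<omega> X Y Z T =
    \<alpha> X * \<omega> Y Z T - \<alpha> Y * \<omega> X Z T + \<alpha> Z * \<omega> X Y T - \<alpha> T * \<omega> X Y Z"

locale quadratic_lie_algebra = lie_algebra scale bracket
  for scale :: "complex \<Rightarrow> 'g::ab_group_add \<Rightarrow> 'g" and bracket :: "'g \<Rightarrow> 'g \<Rightarrow> 'g" +
  fixes B :: "'g \<Rightarrow> 'g \<Rightarrow> complex"
  assumes bilinear_B: "bilinear_form B"
    and symmetric_B: "symmetric_form B"
    and invariant_B: "invariant_form B"
    and nondegenerate_B: "nondegenerate_form B"
begin

definition three_form :: "'g \<Rightarrow> 'g \<Rightarrow> 'g \<Rightarrow> complex"
  where "three_form X Y Z = B (bracket X Y) Z"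

definition dup :: nat
  where "dup = vector_space.dim (\<lambda>c \<alpha> X. c * \<alpha> X)
    {\<alpha>. Vector_Spaces.linear scale (*) \<alpha> \<and> wedge_1_3 \<alpha> three_form = (\<lambda>X Y Z T. 0)}"

definition singular :: bool
  where "singular \<longleftrightarrow> \<not> abelian \<and> dup \<ge> 1"

definition reduced :: bool
  where "reduced \<longleftrightarrow> (UNIV :: 'g set) \<noteq> {0} \<and> (\<forall>X\<in>center. \<forall>Y\<in>center. B X Y = 0)"

definition symmetric_map :: "('g \<Rightarrow> 'g) \<Rightarrow> bool"
  where "symmetric_map D \<longleftrightarrow>
    Vector_Spaces.linear scale scale D \<and> (\<forall>X Y. B (D X) Y = B X (D Y))"

definition centromorphism :: "('g \<Rightarrow> 'g) \<Rightarrow> bool"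
  where "centromorphism D \<longleftrightarrow> symmetric_map D \<and>
    (\<forall>X Y. D (bracket X Y) = bracket (D X) Y \<and> bracket (D X) Y = bracket X (D Y))"

end

end

theory Submission
  imports Defs
begin

text \<open>
  Let \<open>I(X,Y,Z) = B([X,Y],Z)\<close>. Singularity provides a linear form \<open>\<alpha> \<noteq> 0\<close> with
  \<open>\<alpha> \<and> I = 0\<close> and, after rescaling, a vector \<open>v\<close> with \<open>\<alpha>(v) = 1\<close>. The form \<open>\<alpha>\<close> alone forces a
  centromorphism \<open>D\<close> to be scalar modulo maps into the center. Invariance makes
  \<open>J(X,Y,Z) = I(DX,Y,Z)\<close> again alternating, since \<open>D\<close> may be moved to any of the three arguments.

  The kernel of \<open>\<alpha>\<close> is stable under \<open>D\<close>: if \<open>\<alpha>(X) = 0\<close> but \<open>\<alpha>(DX) \<noteq> 0\<close>, then the identity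
  \<open>\<alpha> \<and> I = 0\<close> shows first that \<open>X\<close> is central, hence that \<open>DX\<close> is central, and then that \<open>I = 0\<close>,
  which is excluded because the algebra is not Abelian (\<open>centromorphism_preserves_kernel\<close>).
  Therefore \<open>\<alpha> \<circ> D = \<mu> \<alpha>\<close> with \<open>\<mu> = \<alpha>(Dv)\<close>, and \<open>E = D - \<mu> Id\<close> is a centromorphism with
  \<open>\<alpha> \<circ> E = 0\<close>. For such an \<open>E\<close> the identity \<open>\<alpha> \<and> I = 0\<close> with \<open>EX\<close> and \<open>v\<close> among its arguments
  gives \<open>I(EX,Y,Z) = 0\<close>, so that \<open>E\<close> has values in the center
  (\<open>centromorphism_into_center\<close>), and then \<open>E[X,Y] = [EX,Y] = 0\<close>.

  If the center is totally isotropic, a symmetric map \<open>Z\<close> into it has square zero, because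
  \<open>B(Z(ZX),Y) = B(ZX,ZY) = 0\<close>. Hence \<open>\<mu> Id + Z\<close> is invertible for \<open>\<mu> \<noteq> 0\<close>, by a two-term
  geometric series.

  For the dimension, invariant symmetric forms correspond to centromorphisms via \<open>B(DX,Y)\<close>. With
  \<open>D = \<mu> Id + Z\<close> such a form is \<open>\<mu> B\<close> plus a form \<open>B(ZX,Y)\<close>, and the latter are the symmetric
  combinations of products \<open>B(c_i,X) B(c_j,Y)\<close> for a basis \<open>c_1,...,c_n\<close> of the center. So \<open>B\<close>
  together with the \<open>n(n+1)/2\<close> symmetrized products is a basis of the space of these forms.
\<close>

section \<open>Linear algebra\<close>

lemma sum_apply2: "(\<Sum>i\<in>A. f i) x y = (\<Sum>i\<in>A. f i x y :: complex)"
  by (induction A rule: infinite_finite_induct) auto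

lemma (in vector_space) independent_if_separated:
  assumes "\<And>a. a \<in> P \<Longrightarrow> \<exists>U. subspace U \<and> P - {a} \<subseteq> U \<and> a \<notin> U"
  shows "independent P"
proof
  assume "dependent P"
  then obtain a where "a \<in> P" "a \<in> span (P - {a})"
    by (auto simp: dependent_def)
  then show False
    using assms[of a] span_minimal by blast
qed

context quadratic_lie_algebra
begin

section \<open>Bilinearity rules and representation of functionals\<close>

lemma B_linear_left: "Vector_Spaces.linear scale (*) (\<lambda>X. B X Y)"
  and B_linear_right: "Vector_Spaces.linear scale (*) (B X)"
  using bilinear_B by (auto simp: bilinear_form_def)

lemma B_left [simp]:
  "B (X + X') Y = B X Y + B X' Y" "B (scale c X) Y = c * B X Y" "B 0 Y = 0"
  "B (- X) Y = - B X Y" "B (X - X') Y = B X Y - B X' Y"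
proof -
  interpret l: Vector_Spaces.linear scale "(*)" "\<lambda>X. B X Y" by (rule B_linear_left)
  show "B (X + X') Y = B X Y + B X' Y" "B (scale c X) Y = c * B X Y" "B 0 Y = 0"
   "B (- X) Y = - B X Y" "B (X - X') Y = B X Y - B X' Y"
    by (rule l.add l.scale l.zero l.neg l.diff)+
qed

lemma B_sym: "B X Y = B Y X"
  using symmetric_B by (simp add: symmetric_form_def)

lemma B_right [simp]:
  "B X (Y + Y') = B X Y + B X Y'" "B X (scale c Y) = c * B X Y" "B X 0 = 0"
  "B X (- Y) = - B X Y" "B X (Y - Y') = B X Y - B X Y'"
  using B_left by (simp_all only: B_sym[of X])

lemma bracket_left [simp]:
  "bracket (X + X') Y = bracket X Y + bracket X' Y" "bracket (scale c X) Y = scale c (bracket X Y)"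
  "bracket 0 Y = 0" "bracket (- X) Y = - bracket X Y" "bracket (X - X') Y = bracket X Y - bracket X' Y"
proof -
  interpret l: Vector_Spaces.linear scale scale "\<lambda>X. bracket X Y" by (rule linear_bracket_left)
  show "bracket (X + X') Y = bracket X Y + bracket X' Y" "bracket (scale c X) Y = scale c (bracket X Y)"
  "bracket 0 Y = 0" "bracket (- X) Y = - bracket X Y" "bracket (X - X') Y = bracket X Y - bracket X' Y"
    by (rule l.add l.scale l.zero l.neg l.diff)+
qed

lemma bracket_antisym: "bracket Y X = - bracket X Y"
proof -
  interpret l1: Vector_Spaces.linear scale scale "bracket X" by (rule linear_bracket_right)
  interpret l2: Vector_Spaces.linear scale scale "bracket Y" by (rule linear_bracket_right)
  have "bracket (X + Y) (X + Y) = 0" by (rule bracket_self)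
  then have "bracket X Y + bracket Y X = 0"
    by (simp only: bracket_left l1.add l2.add bracket_self[of X] bracket_self[of Y] add_0_left add_0_right)
  then show ?thesis by (simp add: eq_neg_iff_add_eq_0 add.commute)
qed

lemma bracket_right [simp]:
  "bracket X (Y + Y') = bracket X Y + bracket X Y'" "bracket X (scale c Y) = scale c (bracket X Y)"
  "bracket X 0 = 0" "bracket X (- Y) = - bracket X Y" "bracket X (Y - Y') = bracket X Y - bracket X Y'"
proof -
  interpret l: Vector_Spaces.linear scale scale "bracket X" by (rule linear_bracket_right)
  show "bracket X (Y + Y') = bracket X Y + bracket X Y'" "bracket X (scale c Y) = scale c (bracket X Y)"
  "bracket X 0 = 0" "bracket X (- Y) = - bracket X Y" "bracket X (Y - Y') = bracket X Y - bracket X Y'"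
    by (rule l.add l.scale l.zero l.neg l.diff)+
qed

lemma B_invariant: "B (bracket X Y) Z = B X (bracket Y Z)"
  using invariant_B by (simp add: invariant_form_def)

lemma B_eqI: "(\<And>Y. B X Y = B X' Y) \<Longrightarrow> X = X'"
  using nondegenerate_B unfolding nondegenerate_form_def
  by (metis B_left(5) eq_iff_diff_eq_0)

text \<open>
  In coordinates with respect to a finite basis \<open>N\<close>, the map \<open>X \<mapsto> B(X,\<cdot>)\<close> from the space to its
  dual becomes the endomorphism \<open>T\<close> below; it is injective by non-degeneracy, hence surjective.
\<close>

lemma functional_representable:
  assumes f: "Vector_Spaces.linear scale (*) f"
  shows "\<exists>X. \<forall>Y. f Y = B X Y"
proof -
  obtain S where S: "finite S" "span S = UNIV" using finite_dim by blast
  obtain N where N: "N \<subseteq> S" "independent N" "S \<subseteq> span N"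
    using maximal_independent_subset[of S] by blast
  have fN: "finite N" using N S finite_subset by blast
  have span_N: "span N = UNIV"
    using N(3) S(2) span_mono span_span by (metis top.extremum_uniqueI)
  interpret fd: finite_dimensional_vector_space scale N
    by unfold_locales (use fN N span_N in auto)
  interpret vp: vector_space_pair scale "(*) :: complex \<Rightarrow> complex \<Rightarrow> complex"
    by unfold_locales (auto simp: algebra_simps)
  define T where "T = (\<lambda>X. \<Sum>b\<in>N. scale (B X b) b)"
  have lin: "Vector_Spaces.linear scale scale T"
    unfolding T_def
    by unfold_locales (simp_all add: scale_left_distrib sum.distrib scale_sum_right)
  have coords: "\<forall>b\<in>N. u b = w b" if "(\<Sum>b\<in>N. scale (u b) b) = (\<Sum>b\<in>N. scale (w b) b)" for u w
    using independentD[OF N(2) fN subset_refl, of "\<lambda>b. u b - w b"] that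
    by (simp add: scale_left_diff_distrib sum_subtractf)
  have ext: "f = B X" if "\<forall>b\<in>N. B X b = f b" "Vector_Spaces.linear scale (*) f" for X f
  proof
    fix Y
    have "Y \<in> span N" using span_N by simp
    then show "f Y = B X Y"
      by (rule vp.linear_eq_on[OF that(2) B_linear_right]) (simp add: that(1))
  qed
  have "inj T"
  proof (rule injI)
    fix X X' assume "T X = T X'"
    then have "\<forall>b\<in>N. B X b = B X' b" unfolding T_def by (rule coords)
    from ext[OF this B_linear_right] show "X = X'" by (intro B_eqI) simp
  qed
  then have "surj T"
    by (rule fd.linear_inj_imp_surj[OF lin])
  then obtain X where "T X = (\<Sum>b\<in>N. scale (f b) b)" by (metis surjD)
  then have "\<forall>b\<in>N. B X b = f b" unfolding T_def by (rule coords)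
  from ext[OF this f] show ?thesis by auto
qed

lemma dual_family:
  assumes "independent C"
  shows "\<exists>e. \<forall>c\<in>C. \<forall>d\<in>C. B c (e d) = (if c = d then 1 else 0)"
proof -
  interpret vp: vector_space_pair scale "(*) :: complex \<Rightarrow> complex \<Rightarrow> complex"
    by unfold_locales (auto simp: algebra_simps)
  have "\<exists>X. \<forall>c\<in>C. B c X = (if c = d then 1 else 0)" for d
  proof -
    obtain f where f: "Vector_Spaces.linear scale (*) f" "\<forall>c\<in>C. f c = (if c = d then 1 else 0)"
      using vp.linear_independent_extend[OF assms, of "\<lambda>c. if c = d then 1 else 0"] by blast
    obtain X where "\<forall>Y. f Y = B X Y" using functional_representable[OF f(1)] by blast
    then have "\<forall>c\<in>C. B c X = (if c = d then 1 else 0)" using f(2) by (simp add: B_sym[of _ X])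
    then show ?thesis by blast
  qed
  then have "\<exists>e. \<forall>d. \<forall>c\<in>C. B c (e d) = (if c = d then 1 else 0)"
    by (intro choice allI)
  then show ?thesis by blast
qed

section \<open>The three-form of a quadratic Lie algebra\<close>

lemma center_iff_three_form: "X \<in> center \<longleftrightarrow> (\<forall>Y Z. three_form X Y Z = 0)"
proof
  assume "\<forall>Y Z. three_form X Y Z = 0"
  then have "bracket X Y = 0" for Y
    by (intro B_eqI) (simp add: three_form_def)
  then show "X \<in> center" by (simp add: center_def)
qed (simp add: center_def three_form_def)

lemma three_form_antisym:
  "three_form Y X Z = - three_form X Y Z" "three_form X Z Y = - three_form X Y Z"
proof -
  show "three_form Y X Z = - three_form X Y Z"
    by (simp add: three_form_def bracket_antisym[of Y])
  show "three_form X Z Y = - three_form X Y Z"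
    by (simp add: three_form_def B_invariant bracket_antisym[of Y])
qed

lemma three_form_self: "three_form X Y X = 0"
  using three_form_antisym(2)[of X X Y]
  by (simp add: three_form_def bracket_self)

lemma singular_functional:
  assumes singular
  obtains \<alpha> v where "Vector_Spaces.linear scale (*) \<alpha>" "\<alpha> v = 1"
    "wedge_1_3 \<alpha> three_form = (\<lambda>X Y Z T. 0)"
proof -
  interpret F: vector_space "\<lambda>c (\<alpha> :: 'g \<Rightarrow> complex) X. c * \<alpha> X"
    by (rule vector_space_functionals)
  let ?V = "{\<alpha>. Vector_Spaces.linear scale (*) \<alpha> \<and> wedge_1_3 \<alpha> three_form = (\<lambda>X Y Z T. 0)}"
  have "F.dim ?V \<noteq> 0" using assms by (simp add: singular_def dup_def)
  then have "\<not> ?V \<subseteq> {0}"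
    using F.dim_unique[of "{}" ?V 0] by (auto simp: F.independent_empty)
  then obtain \<alpha> where "\<alpha> \<in> ?V" "\<alpha> \<noteq> 0" by blast
  then obtain w where a: "Vector_Spaces.linear scale (*) \<alpha>"
    "wedge_1_3 \<alpha> three_form = (\<lambda>X Y Z T. 0)" "\<alpha> w \<noteq> 0"
    unfolding zero_fun_def by blast
  interpret l: Vector_Spaces.linear scale "(*)" \<alpha> by (rule a)
  show ?thesis
  proof
    show "\<alpha> (scale (1 / \<alpha> w) w) = 1" using a by (simp add: l.scale)
  qed (use a in simp_all)
qed

section \<open>Centromorphisms of a singular algebra\<close>

lemma three_form_centromorphism:
  assumes "centromorphism E"
  shows "three_form X (E Y) Z = three_form (E X) Y Z"
    and "three_form X Y (E Z) = three_form (E X) Y Z"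
  using assms unfolding centromorphism_def symmetric_map_def three_form_def by metis+

text \<open>
  In \<open>(\<alpha> \<and> I)(DX,X,Z,T) = 0\<close> only \<open>\<alpha>(DX) I(X,Z,T)\<close> survives, since \<open>\<alpha>(X) = 0\<close> and
  \<open>[DX,X] = D[X,X] = 0\<close>. So \<open>\<alpha>(DX) \<noteq> 0\<close> would make \<open>X\<close> central, and a second evaluation of
  \<open>\<alpha> \<and> I\<close> with the central vector \<open>DX\<close> would make every vector central.
\<close>

lemma centromorphism_preserves_kernel:
  assumes D: "centromorphism D" and "\<not> abelian"
    and w: "\<And>X Y Z T. wedge_1_3 \<alpha> three_form X Y Z T = 0"
    and X: "\<alpha> X = 0"
  shows "\<alpha> (D X) = 0"
proof (rule ccontr)
  assume ne: "\<alpha> (D X) \<noteq> 0"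
  have "three_form (D X) X Z = 0" for Z
    using three_form_centromorphism(1)[OF D, of X X Z] three_form_antisym(1)[of "D X" X Z]
    by simp
  \<comment> \<open>The vector \<open>X\<close> is central, and \<open>D\<close> preserves the center.\<close>
  then have X0: "three_form X Z T = 0" for Z T
    using w[of "D X" X Z T] ne X by (simp add: wedge_1_3_def)
  then have "three_form (D X) Z T = 0" for Z T
    using three_form_centromorphism(1)[OF D, of X Z T] by simp
  then have "three_form Y Z T = 0" for Y Z T
    using w[of "D X" Y Z T] ne by (simp add: wedge_1_3_def)
  then have abelian
    using center_iff_three_form by (auto simp: abelian_def center_def)
  with \<open>\<not> abelian\<close> show False ..
qed

text \<open>
  The form \<open>J = I(E\<cdot>,\<cdot>,\<cdot>)\<close> is alternating and, since \<open>\<alpha> \<circ> E = 0\<close>, its values reduce to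
  \<open>J(X,Y,v) = J(v,X,Y)\<close>. The same reduction applied once more leads to \<open>J(v,\<cdot>,v)\<close>, which is zero.
\<close>

lemma centromorphism_into_center:
  assumes E: "centromorphism E" and v: "\<alpha> v = 1"
    and w: "\<And>X Y Z T. wedge_1_3 \<alpha> three_form X Y Z T = 0"
    and aE: "\<And>X. \<alpha> (E X) = 0"
  shows "E X \<in> center"
proof -
  let ?J = "\<lambda>X. three_form (E X)"
  have J: "?J X Y Z = \<alpha> Z * ?J X Y v - \<alpha> Y * ?J X Z v" for X Y Z
    using w[of "E X" Y Z v] aE v by (simp add: wedge_1_3_def)
  have "?J v Y v = 0" for Y
    using three_form_centromorphism(1)[OF E, of v Y v] three_form_self[of v "E Y"] by simp
  then have "?J v X Y = 0" for X Y
    using J[of v X Y] by simp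
  moreover have "?J X Y v = ?J v X Y" for X Y
    using three_form_centromorphism(2)[OF E, of X Y v] three_form_antisym(1)[of X "E v" Y]
      three_form_antisym(2)[of X Y "E v"] by simp
  ultimately have "?J X Y v = 0" for X Y by simp
  then have "?J X Y Z = 0" for Y Z
    using J[of X Y Z] by simp
  then show ?thesis
    by (simp add: center_iff_three_form)
qed

lemma symmetric_map_simps:
  assumes "symmetric_map D"
  shows "D (X + Y) = D X + D Y" "D (scale c X) = scale c (D X)" "D 0 = 0" "D (X - Y) = D X - D Y"
    "B (D X) Y = B X (D Y)"
proof -
  interpret l: Vector_Spaces.linear scale scale D
    using assms by (simp add: symmetric_map_def)
  show "D (X + Y) = D X + D Y" "D (scale c X) = scale c (D X)" "D 0 = 0" "D (X - Y) = D X - D Y"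
    by (rule l.add l.scale l.zero l.diff)+
  show "B (D X) Y = B X (D Y)" using assms by (simp add: symmetric_map_def)
qed

lemma symmetric_map_shift:
  assumes "symmetric_map D"
  shows "symmetric_map (\<lambda>X. D X - scale \<mu> X)"
  unfolding symmetric_map_def
proof (intro conjI allI)
  show "Vector_Spaces.linear scale scale (\<lambda>X. D X - scale \<mu> X)"
    by unfold_locales (simp_all add: symmetric_map_simps[OF assms] scale_right_distrib
        scale_right_diff_distrib scale_left_commute)
qed (simp add: symmetric_map_simps(5)[OF assms])

lemma vanishes_on_derived:
  assumes "symmetric_map Z" "\<And>X Y. Z (bracket X Y) = 0" "X \<in> derived_algebra"
  shows "Z X = 0"
  using assms(3) unfolding derived_algebra_def
  by (induction rule: span_induct_alt)
    (auto simp: symmetric_map_simps[OF assms(1)] assms(2))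

text \<open>
  The scalar is the eigenvalue of the transpose of \<open>D\<close> on \<open>\<alpha>\<close>, which exists because the
  hyperplane \<open>ker \<alpha>\<close> is stable under \<open>D\<close>.
\<close>

lemma centromorphism_decomposition:
  assumes singular and D: "centromorphism D"
  obtains \<mu> where "range (\<lambda>X. D X - scale \<mu> X) \<subseteq> center"
    "\<And>X. X \<in> derived_algebra \<Longrightarrow> D X - scale \<mu> X = 0"
proof -
  obtain \<alpha> v where lin: "Vector_Spaces.linear scale (*) \<alpha>" and v: "\<alpha> v = 1"
    and wedge: "wedge_1_3 \<alpha> three_form = (\<lambda>X Y Z T. 0)"
    using singular_functional[OF assms(1)] by blast
  have w: "wedge_1_3 \<alpha> three_form X Y Z T = 0" for X Y Z T
    by (simp add: wedge)
  interpret l: Vector_Spaces.linear scale "(*)" \<alpha> by (rule lin)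
  have sD: "symmetric_map D" using D by (simp add: centromorphism_def)
  define \<mu> where "\<mu> = \<alpha> (D v)"
  define E where "E = (\<lambda>X. D X - scale \<mu> X)"
  have sE: "symmetric_map E" unfolding E_def by (rule symmetric_map_shift[OF sD])
  have E: "centromorphism E"
    using D sE by (auto simp: centromorphism_def E_def)
  have "\<alpha> (E X) = 0" for X
  proof -
    have "\<alpha> (D (X - scale (\<alpha> X) v)) = 0"
      using assms(1) by (intro centromorphism_preserves_kernel[OF D _ w])
        (simp_all add: singular_def l.diff l.scale v)
    then show ?thesis
      by (simp add: E_def \<mu>_def symmetric_map_simps[OF sD] l.diff l.scale)
  qed
  then have c: "E X \<in> center" for X
    by (rule centromorphism_into_center[OF E v w])
  then have "E (bracket X Y) = 0" for X Y
    using E by (auto simp: centromorphism_def center_def)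
  with vanishes_on_derived[OF sE] c show ?thesis
    by (intro that[of \<mu>]) (auto simp: E_def)
qed

lemma centromorphism_of_decomposition:
  assumes Z: "symmetric_map Z" "range Z \<subseteq> center" "\<And>X. X \<in> derived_algebra \<Longrightarrow> Z X = 0"
  shows "centromorphism (\<lambda>X. scale \<mu> X + Z X)"
proof -
  have "symmetric_map (\<lambda>X. scale \<mu> X + Z X)"
    using symmetric_map_shift[OF Z(1), of "- \<mu>"] by (simp add: add.commute)
  moreover have "Z (bracket X Y) = 0" for X Y
    by (rule Z(3)) (auto simp: derived_algebra_def intro: span_base)
  moreover have "bracket (Z X) Y = 0" "bracket Y (Z X) = 0" for X Y
    using Z(2) bracket_antisym[of Y "Z X"] by (auto simp: center_def)
  ultimately show ?thesis by (simp add: centromorphism_def)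
qed

section \<open>Invertibility\<close>

text \<open>
  Isotropy of the center enters through \<open>Z \<circ> Z = 0\<close>, which makes
  \<open>\<mu>\<^sup>-\<^sup>1 Id - \<mu>\<^sup>-\<^sup>2 Z\<close> the inverse. Conversely \<open>Z\<close> is not onto, since the center is a proper
  subspace.
\<close>

lemma bij_decomposition_iff:
  assumes reduced "\<not> abelian"
    and Z: "symmetric_map Z" "range Z \<subseteq> center"
  shows "bij (\<lambda>X. scale \<mu> X + Z X) \<longleftrightarrow> \<mu> \<noteq> 0"
proof
  assume "bij (\<lambda>X. scale \<mu> X + Z X)"
  show "\<mu> \<noteq> 0"
  proof
    assume "\<mu> = 0"
    then have "surj Z" using \<open>bij _\<close> by (simp add: bij_def)
    with Z(2) have "center = UNIV" by auto
    with \<open>\<not> abelian\<close> show False by (auto simp: abelian_def center_def)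
  qed
next
  assume "\<mu> \<noteq> 0"
  have "Z (Z X) = 0" for X
  proof (rule B_eqI)
    fix Y
    have "Z X \<in> center" "Z Y \<in> center" using Z(2) by auto
    then have "B (Z X) (Z Y) = 0" using assms(1) by (simp add: reduced_def)
    then show "B (Z (Z X)) Y = B 0 Y" by (simp add: symmetric_map_simps(5)[OF Z(1)])
  qed
  with \<open>\<mu> \<noteq> 0\<close> show "bij (\<lambda>X. scale \<mu> X + Z X)"
    by (intro o_bij[of "\<lambda>X. scale (1 / \<mu>) X - scale (1 / \<mu>\<^sup>2) (Z X)"])
      (simp_all add: fun_eq_iff symmetric_map_simps[OF Z(1)] scale_right_distrib
        scale_right_diff_distrib power2_eq_square)
qed

section \<open>The quadratic dimension\<close>

text \<open>
  Non-degeneracy of \<open>B\<close> determines \<open>D\<close> uniquely, so each property of the form \<open>b\<close> passes to \<open>D\<close>: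
  linearity, symmetry, and, from invariance, compatibility with the bracket.
\<close>

lemma invariant_form_represented:
  assumes b: "bilinear_form b" "symmetric_form b" "invariant_form b"
  obtains D where "centromorphism D" "\<And>X Y. b X Y = B (D X) Y"
proof -
  have "\<exists>X'. \<forall>Y. b X Y = B X' Y" for X
    using b(1) by (intro functional_representable) (simp add: bilinear_form_def)
  then obtain D where D: "\<And>X Y. b X Y = B (D X) Y" by metis
  have bl: "b (X + X') Y = b X Y + b X' Y" "b (scale c X) Y = c * b X Y" for X X' Y c
  proof -
    interpret l: Vector_Spaces.linear scale "(*)" "\<lambda>X. b X Y"
      using b(1) by (simp add: bilinear_form_def)
    show "b (X + X') Y = b X Y + b X' Y" "b (scale c X) Y = c * b X Y"
      by (rule l.add l.scale)+
  qed
  have lin: "Vector_Spaces.linear scale scale D"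
    by unfold_locales (rule B_eqI, simp add: D[symmetric] bl)+
  have "B (D X) Y = B X (D Y)" for X Y
    using b(2) D B_sym by (metis symmetric_form_def)
  with lin have sD: "symmetric_map D" by (simp add: symmetric_map_def)
  have D_left: "D (bracket X Y) = bracket (D X) Y" for X Y
    using b(3) by (intro B_eqI) (simp add: D[symmetric] B_invariant invariant_form_def)
  have "bracket (D X) Y = bracket X (D Y)" for X Y
  proof -
    have "bracket X (D Y) = - bracket (D Y) X" by (rule bracket_antisym)
    also have "\<dots> = - D (bracket Y X)" by (simp add: D_left)
    also have "\<dots> = D (bracket X Y)"
      using symmetric_map_simps(4)[OF sD, of 0] symmetric_map_simps(3)[OF sD] 
      by (simp add: bracket_antisym[of Y X])
    finally show ?thesis by (simp add: D_left)
  qed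
  with sD D_left show ?thesis
    by (intro that[of D]) (simp_all add: centromorphism_def D)
qed


lemma B_center_bracket: "X \<in> center \<Longrightarrow> B X (bracket Y Z) = 0"
  by (simp add: B_invariant[symmetric] center_def)

text \<open>
  Here \<open>c\<close> enumerates a finite set \<open>C\<close> whose span contains the image of \<open>Z\<close>, and \<open>e\<close> is a dual
  family, so that pairing with \<open>e j\<close> extracts the \<open>j\<close>-th coordinate of \<open>Z X\<close>. By symmetry of \<open>Z\<close>
  this coordinate is \<open>B (Z (e j)) X\<close>, which can be expanded in the same way.
\<close>

lemma symmetric_map_expansion:
  assumes Z: "symmetric_map Z" "range Z \<subseteq> span C" and "finite C"
    and c: "bij_betw c {..<n::nat} C"
    and e: "\<And>i j. i < n \<Longrightarrow> j < n \<Longrightarrow> B (c i) (e j) = (if i = j then 1 else 0)"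
  shows "B (Z X) Y = (\<Sum>j<n. \<Sum>i<n. B (Z (e j)) (e i) * (B (c i) X * B (c j) Y))"
proof -
  have "\<exists>u. Z X = (\<Sum>i<n. scale (u i) (c i))" for X
  proof -
    have "Z X \<in> span C" using Z(2) by auto
    then obtain w where "Z X = (\<Sum>x\<in>C. scale (w x) x)"
      using \<open>finite C\<close> by (auto simp: span_finite)
    also have "\<dots> = (\<Sum>i<n. scale (w (c i)) (c i))"
      by (rule sum.reindex_bij_betw[OF c, symmetric])
    finally show ?thesis by (intro exI[of _ "\<lambda>i. w (c i)"])
  qed
  then obtain z where z: "\<And>X. Z X = (\<Sum>i<n. scale (z X i) (c i))" by metis
  have B_sum: "B (\<Sum>i<n. scale (u i) (c i)) Y = (\<Sum>i<n. u i * B (c i) Y)" for u Y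
  proof -
    interpret l: Vector_Spaces.linear scale "(*)" "\<lambda>X. B X Y" by (rule B_linear_left)
    show ?thesis by (simp add: l.sum)
  qed
  have BZ: "B (Z X) Y = (\<Sum>i<n. z X i * B (c i) Y)" for X Y
    by (simp add: z B_sum)
  have z_eq: "z X j = B (Z X) (e j)" if "j < n" for X j
    using that by (simp add: BZ e if_distrib[of "\<lambda>x. _ * x"] cong: if_cong)
  have "z X j = (\<Sum>i<n. B (Z (e j)) (e i) * B (c i) X)" if "j < n" for X j
  proof -
    have "z X j = B (Z (e j)) X"
      using z_eq[OF that] symmetric_map_simps(5)[OF Z(1)] B_sym by metis
    also have "\<dots> = (\<Sum>i<n. B (Z (e j)) (e i) * B (c i) X)"
      by (subst BZ) (simp add: z_eq)
    finally show ?thesis .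
  qed
  then show ?thesis
    by (simp add: BZ[of X] sum_distrib_right mult.assoc)
qed

text \<open>
  Index the symmetrized products \<open>q (j, i)\<close> of \<open>B(c_i,\<cdot>)\<close> and \<open>B(c_j,\<cdot>)\<close> by \<open>i \<le> j < n\<close>.
  Evaluation at pairs of dual vectors separates them from each other. They all vanish when one
  argument is a bracket \<open>P\<close>, whereas \<open>B(P,R) \<noteq> 0\<close> for some \<open>P\<close> and \<open>R\<close>, which separates \<open>B\<close> from
  them.
\<close>

lemma quadratic_dim_formula:
  assumes singular
  shows "2 * quadratic_dim = 2 + dim center * (1 + dim center)"
proof -
  interpret F: vector_space "\<lambda>k (b :: 'g \<Rightarrow> 'g \<Rightarrow> complex) X Y. k * b X Y"
    by (rule vector_space_bilinear_forms)
  let ?V = "{b. bilinear_form b \<and> symmetric_form b \<and> invariant_form b}"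
  define n where "n = dim center"
  obtain C where C: "C \<subseteq> center" "independent C" "center \<subseteq> span C" "card C = n"
    unfolding n_def by (rule basis_exists)
  obtain S where "finite S" "span S = UNIV" using finite_dim by blast
  then have "finite C"
    using independent_span_bound[of S C] C(2) by auto
  then obtain c where c: "bij_betw c {..<n} C"
    using ex_bij_betw_nat_finite C(4) by (auto simp: atLeast0LessThan)
  then have c_center: "c i \<in> center" if "i < n" for i
    using C(1) that by (auto dest!: bij_betwE)
  obtain e' where e': "\<forall>x\<in>C. \<forall>y\<in>C. B x (e' y) = (if x = y then 1 else 0)"
    using dual_family[OF C(2)] by blast
  define e where "e = (\<lambda>i. e' (c i))"
  have e: "B (c i) (e j) = (if i = j then 1 else 0)" if "i < n" "j < n" for i j
    using e' c that by (auto simp: e_def bij_betw_def inj_on_def)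
  obtain P1 P2 where "bracket P1 P2 \<noteq> 0"
    using assms by (auto simp: singular_def abelian_def)
  then obtain R where R: "B (bracket P1 P2) R \<noteq> 0"
    using B_eqI[of "bracket P1 P2" 0] by auto
  define P where "P = bracket P1 P2"
  have PR: "B P R \<noteq> 0" and P: "\<And>X. X \<in> center \<Longrightarrow> B X P = 0"
    using R by (simp_all add: P_def B_center_bracket)
  define q where "q = (\<lambda>(j, i) X Y. B (c i) X * B (c j) Y + B (c j) X * B (c i) Y)"
  define J where "J = (SIGMA j:{..<n}. {..j})"
  have q_sym: "q (i, j) = q (j, i)" for i j
    by (simp add: q_def fun_eq_iff)
  have q_P: "q p P Y = 0" if "p \<in> J" for p Y
    using that P c_center by (auto simp: q_def J_def)
  have q_e: "q (j, i) (e l) (e k) = (if (j, i) = (l, k) then (if k = l then 2 else 1) else 0)"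
    if "(j, i) \<in> J" "(l, k) \<in> J" for i j k l
    using that by (auto simp: q_def J_def e)
  have q_ne: "q p (e l) (e k) \<noteq> 0 \<longleftrightarrow> p = (l, k)" if "p \<in> J" "(l, k) \<in> J" for p k l
    using q_e[of "fst p" "snd p" l k] that by auto
  have inj: "inj_on q J"
  proof (rule inj_onI)
    fix p p' assume "p \<in> J" "p' \<in> J" "q p = q p'"
    then show "p = p'" using q_ne[of p "fst p'" "snd p'"] q_ne[of p' "fst p'" "snd p'"] by simp
  qed
  have B_notin: "B \<notin> q ` J" using PR q_P by auto

  have "F.independent (insert B (q ` J))"
  proof (rule F.independent_if_separated)
    fix b assume "b \<in> insert B (q ` J)"
    then consider "b = B" | l k where "b = q (l, k)" "(l, k) \<in> J" by auto
    then show "\<exists>U. F.subspace U \<and> insert B (q ` J) - {b} \<subseteq> U \<and> b \<notin> U"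
    proof cases
      case 1
      have "F.subspace {f. f P R = 0}" by (auto simp: F.subspace_def)
      with 1 show ?thesis
        using PR q_P by (intro exI[of _ "{f. f P R = 0}"]) auto
    next
      case 2
      let ?U = "{f. f (e l) (e k) * B P R = f P R * B (e l) (e k)}"
      \<comment> \<open>Evaluation at \<open>(e l, e k)\<close>, corrected by a multiple of evaluation at \<open>(P, R)\<close> so that it
        vanishes on \<open>B\<close> as well.\<close>
      have "F.subspace ?U" by (auto simp: F.subspace_def algebra_simps)
      moreover have "insert B (q ` J) - {b} \<subseteq> ?U"
        using q_P q_ne[OF _ 2(2)] by (auto simp: 2(1))
      moreover have "b \<notin> ?U"
        using q_P q_ne[OF 2(2) 2(2)] PR 2 by auto
      ultimately show ?thesis by blast
    qed
  qed
  moreover have "insert B (q ` J) \<subseteq> ?V"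
  proof -
    have "q p \<in> ?V" if "p \<in> J" for p
    proof -
      obtain i j where p: "p = (j, i)" by (cases p)
      have ij: "c i \<in> center" "c j \<in> center" using that c_center by (auto simp: J_def p)
      have "bilinear_form (q p)"
        unfolding bilinear_form_def q_def p
        by (intro conjI allI) (unfold_locales; simp add: algebra_simps)+
      moreover have "symmetric_form (q p)"
        by (simp add: symmetric_form_def q_def p)
      moreover have "invariant_form (q p)"
        using ij by (simp add: invariant_form_def q_def p B_center_bracket)
      ultimately show ?thesis by simp
    qed
    then show ?thesis using bilinear_B symmetric_B invariant_B by auto
  qed
  moreover have "?V \<subseteq> F.span (insert B (q ` J))"
  proof
    fix b assume "b \<in> ?V"
    then obtain D where D: "centromorphism D" and bD: "\<And>X Y. b X Y = B (D X) Y"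
      using invariant_form_represented by blast
    then have sD: "symmetric_map D" by (simp add: centromorphism_def)
    obtain \<mu> where \<mu>: "range (\<lambda>X. D X - scale \<mu> X) \<subseteq> center"
      using centromorphism_decomposition[OF assms D] by blast
    define Z where "Z = (\<lambda>X. D X - scale \<mu> X)"
    have sZ: "symmetric_map Z" unfolding Z_def by (rule symmetric_map_shift[OF sD])
    define a where "a = (\<lambda>j i. B (Z (e j)) (e i))"
    have a_sym: "a i j = a j i" for i j
      using symmetric_map_simps(5)[OF sZ] B_sym by (simp add: a_def)
    have "range Z \<subseteq> span C" using \<mu> C(3) by (auto simp: Z_def)
    then have BZ_a: "B (Z X) Y = (\<Sum>j<n. \<Sum>i<n. a j i * (B (c i) X * B (c j) Y))" for X Y
      unfolding a_def by (rule symmetric_map_expansion[OF sZ _ \<open>finite C\<close> c e])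
    \<comment> \<open>The average of this expansion and its transpose is a combination of the forms \<open>q\<close>.\<close>
    have BZ_a': "B (Z X) Y = (\<Sum>j<n. \<Sum>i<n. a j i * (B (c j) X * B (c i) Y))" for X Y
      unfolding BZ_a by (subst sum.swap) (simp add: a_sym)
    have b_eq: "b = (\<lambda>X Y. \<mu> * B X Y) + (\<Sum>j<n. \<Sum>i<n. (\<lambda>X Y. (a j i / 2) * q (j, i) X Y))"
    proof (intro ext)
      fix X Y
      have "b X Y = \<mu> * B X Y + B (Z X) Y" by (simp add: bD Z_def)
      also have "B (Z X) Y = (\<Sum>j<n. \<Sum>i<n. (a j i / 2) * q (j, i) X Y)"
      proof -
        have "2 * B (Z X) Y = B (Z X) Y + B (Z X) Y" by simp
        also have "\<dots> = (\<Sum>j<n. \<Sum>i<n. a j i * q (j, i) X Y)"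
          by (subst BZ_a, subst BZ_a')
            (simp add: q_def sum.distrib[symmetric] distrib_left)
        also have "\<dots> = 2 * (\<Sum>j<n. \<Sum>i<n. (a j i / 2) * q (j, i) X Y)"
          by (simp add: sum_distrib_left)
        finally show ?thesis by simp
      qed
      finally show "b X Y = ((\<lambda>X Y. \<mu> * B X Y)
          + (\<Sum>j<n. \<Sum>i<n. (\<lambda>X Y. (a j i / 2) * q (j, i) X Y))) X Y"
        by (simp add: sum_apply2)
    qed
    have q_span: "q (j, i) \<in> F.span (insert B (q ` J))" if "j < n" "i < n" for i j
    proof -
      have "(j, i) \<in> J \<or> (i, j) \<in> J" using that by (auto simp: J_def)
      then have "q (j, i) \<in> q ` J" using q_sym[of i j] by (metis imageI)
      then show ?thesis by (auto intro: F.span_base)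
    qed
    have "(\<lambda>X Y. \<mu> * B X Y) \<in> F.span (insert B (q ` J))"
      by (intro F.span_scale F.span_base) simp
    moreover have "(\<Sum>j<n. \<Sum>i<n. (\<lambda>X Y. (a j i / 2) * q (j, i) X Y)) \<in> F.span (insert B (q ` J))"
      by (intro F.span_sum F.span_scale q_span) auto
    ultimately show "b \<in> F.span (insert B (q ` J))"
      by (simp only: b_eq F.span_add)
  qed
  moreover have "card (insert B (q ` J)) = Suc (card J)"
    using B_notin inj by (simp add: card_image J_def)
  ultimately have "quadratic_dim = Suc (card J)"
    unfolding quadratic_dim_def by (intro F.dim_unique)
  moreover have "2 * card J = n * (1 + n)"
    unfolding J_def by (induction n) (simp_all add: card_SigmaI)
  ultimately show ?thesis by (simp add: n_def)
qed

end

section \<open>Centromorphisms and quadratic dimension\<close>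

theorem proposition8p2:
  fixes scale :: "complex \<Rightarrow> 'g::ab_group_add \<Rightarrow> 'g"
    and bracket :: "'g \<Rightarrow> 'g \<Rightarrow> 'g"
    and B :: "'g \<Rightarrow> 'g \<Rightarrow> complex"
    and D :: "'g \<Rightarrow> 'g"
  assumes "quadratic_lie_algebra scale bracket B"
    and "quadratic_lie_algebra.reduced bracket B"
    and "quadratic_lie_algebra.singular scale bracket B"
    and "quadratic_lie_algebra.symmetric_map scale B D"
  shows "(quadratic_lie_algebra.centromorphism scale bracket B D \<longleftrightarrow>
            (\<exists>\<mu> Z. quadratic_lie_algebra.symmetric_map scale B Z \<and>
                   range Z \<subseteq> lie_algebra.center bracket \<and>
                   (\<forall>X\<in>lie_algebra.derived_algebra scale bracket. Z X = 0) \<and>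
                   D = (\<lambda>X. scale \<mu> X + Z X))) \<and>
         (\<forall>\<mu> Z. quadratic_lie_algebra.symmetric_map scale B Z \<and>
                range Z \<subseteq> lie_algebra.center bracket \<and>
                (\<forall>X\<in>lie_algebra.derived_algebra scale bracket. Z X = 0) \<and>
                D = (\<lambda>X. scale \<mu> X + Z X) \<longrightarrow>
            (bij D \<longleftrightarrow> \<mu> \<noteq> 0)) \<and>
         real (lie_algebra.quadratic_dim scale bracket) =
           1 + real (vector_space.dim scale (lie_algebra.center bracket)) *
               (1 + real (vector_space.dim scale (lie_algebra.center bracket))) / 2"
proof -
  interpret quadratic_lie_algebra scale bracket B by (rule assms(1))
  have "\<not> abelian" using assms(3) by (simp add: singular_def)
  have "\<exists>\<mu> Z. symmetric_map Z \<and> range Z \<subseteq> center \<and> (\<forall>X\<in>derived_algebra. Z X = 0) \<and>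
      D = (\<lambda>X. scale \<mu> X + Z X)" if D: "centromorphism D"
  proof -
    obtain \<mu> where "range (\<lambda>X. D X - scale \<mu> X) \<subseteq> center"
      "\<And>X. X \<in> derived_algebra \<Longrightarrow> D X - scale \<mu> X = 0"
      using centromorphism_decomposition[OF assms(3) D] by blast
    with symmetric_map_shift[OF assms(4), of \<mu>] show ?thesis
      by (intro exI[of _ \<mu>] exI[of _ "\<lambda>X. D X - scale \<mu> X"]) simp
  qed
  moreover have "centromorphism D"
    if "\<exists>\<mu> Z. symmetric_map Z \<and> range Z \<subseteq> center \<and> (\<forall>X\<in>derived_algebra. Z X = 0) \<and>
      D = (\<lambda>X. scale \<mu> X + Z X)"
    using that centromorphism_of_decomposition by blast
  moreover have "bij D \<longleftrightarrow> \<mu> \<noteq> 0"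
    if "symmetric_map Z \<and> range Z \<subseteq> center \<and> (\<forall>X\<in>derived_algebra. Z X = 0) \<and>
      D = (\<lambda>X. scale \<mu> X + Z X)" for \<mu> Z
    using that bij_decomposition_iff[OF assms(2) \<open>\<not> abelian\<close>, of Z \<mu>] by blast
  moreover have "real quadratic_dim = 1 + real (dim center) * (1 + real (dim center)) / 2"
    using arg_cong[OF quadratic_dim_formula[OF assms(3)], of real] by (simp add: field_simps)
  ultimately show ?thesis by blast
qed

end
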